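(* Let $F_1,\dots,F_n$ be univariate Gaussian distributions with variances $\sigma_1^2,\dots,\sigma_n^2$. The tuple $(F_1,\dots,F_n)$ supports an NCD joint mix if and only if $$2\max_{i\in[n]}\sigma_i^2\le\sum_{i\in[n]}\sigma_i^2,$$ and likewise $(F_1,\dots,F_n)$ supports an NA joint mix if and only if this inequality holds. Moreover, when the inequality holds, such an NCD or NA joint mix can be chosen as a Gaussian random vector.
   Context: $[n]=\{1,\dots,n\}$. A random vector $\mathbf X=(X_1,\dots,X_n)$ is a joint mix if $\sum_{i=1}^nX_i=c$ almost surely for some constant $c\in\mathbb R$. The tuple $(F_1,\dots,F_n)$ of distributions on $\mathbb R$ supports a joint mix $\mathbf X$ if $\mathbf X$ is a joint mix with $X_i\sim F_i$ for all $i\in[n]$. $\mathbf X$ is negative correlation dependent (NCD) if $\mathrm{Cov}(X_i,X_j)\le0$ for all $i\ne j$. $\mathbf X$ is negatively associated (NA) if $\mathrm{Cov}(f(\mathbf X_A),g(\mathbf X_B))\le 0$ for any disjoint $A,B\subseteq[n]$ and any real-valued coordinate-wise increasing (non-decreasing) functions $f,g$ such that $f(\mathbf X_A)$ and $g(\mathbf X_B)$ have finite second moments, where $\mathbf X_A=(X_i)_{i\in A}$. *)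

theory Defs
  imports "HOL-Probability.Probability"
begin

definition random_vector :: "nat \<Rightarrow> 'a measure \<Rightarrow> (nat \<Rightarrow> 'a \<Rightarrow> real) \<Rightarrow> bool" where
  "random_vector n M X \<longleftrightarrow> prob_space M \<and> (\<forall>i\<in>{1..n}. X i \<in> borel_measurable M)"

definition joint_mix :: "nat \<Rightarrow> 'a measure \<Rightarrow> (nat \<Rightarrow> 'a \<Rightarrow> real) \<Rightarrow> bool" where
  "joint_mix n M X \<longleftrightarrow> random_vector n M X \<and> (\<exists>c. AE \<omega> in M. (\<Sum>i\<in>{1..n}. X i \<omega>) = c)"

definition joint_mix_with_marginals ::
    "nat \<Rightarrow> (nat \<Rightarrow> real measure) \<Rightarrow> 'a measure \<Rightarrow> (nat \<Rightarrow> 'a \<Rightarrow> real) \<Rightarrow> bool" where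
  "joint_mix_with_marginals n F M X \<longleftrightarrow>
     joint_mix n M X \<and> (\<forall>i\<in>{1..n}. distr M borel (X i) = F i)"

definition square_integrable :: "'a measure \<Rightarrow> ('a \<Rightarrow> real) \<Rightarrow> bool" where
  "square_integrable M Y \<longleftrightarrow> Y \<in> borel_measurable M \<and> integrable M (\<lambda>\<omega>. (Y \<omega>)\<^sup>2)"

definition covariance :: "'a measure \<Rightarrow> ('a \<Rightarrow> real) \<Rightarrow> ('a \<Rightarrow> real) \<Rightarrow> real" where
  "covariance M Y Z =
     integral\<^sup>L M (\<lambda>\<omega>. (Y \<omega> - integral\<^sup>L M Y) * (Z \<omega> - integral\<^sup>L M Z))"

(* Square integrability ensures that the covariances exist; a Bochner integral that does not
   exist would silently be 0. *)
definition NCD :: "nat \<Rightarrow> 'a measure \<Rightarrow> (nat \<Rightarrow> 'a \<Rightarrow> real) \<Rightarrow> bool" where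
  "NCD n M X \<longleftrightarrow> random_vector n M X \<and>
     (\<forall>i\<in>{1..n}. square_integrable M (X i)) \<and>
     (\<forall>i\<in>{1..n}. \<forall>j\<in>{1..n}. i \<noteq> j \<longrightarrow> covariance M (X i) (X j) \<le> 0)"

(* R^A is the set of extensional functions A \<rightarrow>\<^sub>E UNIV; such functions agree outside A, so the
   pointwise order used by mono_on is the coordinatewise order on R^A. *)
definition subvector :: "(nat \<Rightarrow> 'a \<Rightarrow> real) \<Rightarrow> nat set \<Rightarrow> 'a \<Rightarrow> nat \<Rightarrow> real" where
  "subvector X A \<omega> = restrict (\<lambda>i. X i \<omega>) A"

(* A monotone f need not be Borel; only f(X_A) is required to be a random variable. *)
definition NA :: "nat \<Rightarrow> 'a measure \<Rightarrow> (nat \<Rightarrow> 'a \<Rightarrow> real) \<Rightarrow> bool" where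
  "NA n M X \<longleftrightarrow> random_vector n M X \<and>
     (\<forall>A B f g. A \<subseteq> {1..n} \<longrightarrow> B \<subseteq> {1..n} \<longrightarrow> A \<inter> B = {} \<longrightarrow>
        mono_on (A \<rightarrow>\<^sub>E UNIV) f \<longrightarrow> mono_on (B \<rightarrow>\<^sub>E UNIV) g \<longrightarrow>
        square_integrable M (\<lambda>\<omega>. f (subvector X A \<omega>)) \<longrightarrow>
        square_integrable M (\<lambda>\<omega>. g (subvector X B \<omega>)) \<longrightarrow>
        covariance M (\<lambda>\<omega>. f (subvector X A \<omega>)) (\<lambda>\<omega>. g (subvector X B \<omega>)) \<le> 0)"

(* The normal law with mean m and standard deviation s \<ge> 0; for s = 0 it is the point mass at m,
   where normal_density would be 0. *)
definition gaussian :: "real \<Rightarrow> real \<Rightarrow> real measure" where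
  "gaussian m s =
     (if s = 0 then return borel m else density lborel (\<lambda>x. ennreal (normal_density m s x)))"

(* All linear combinations are Gaussian, possibly degenerate: the covariance matrix of a
   joint mix is singular. *)
definition gaussian_vector :: "nat \<Rightarrow> 'a measure \<Rightarrow> (nat \<Rightarrow> 'a \<Rightarrow> real) \<Rightarrow> bool" where
  "gaussian_vector n M X \<longleftrightarrow> random_vector n M X \<and>
     (\<forall>a. \<exists>m s. s \<ge> 0 \<and> distr M borel (\<lambda>\<omega>. \<Sum>i\<in>{1..n}. a i * X i \<omega>) = gaussian m s)"

(* HOL cannot quantify existentially over the type of the sample space. The type nat \<Rightarrow> real
   loses no generality: by the lemmas on vector_law below, the coordinates under the law of X
   inherit each property from X, whatever its sample space. *)
definition supports_NCD_joint_mix :: "nat \<Rightarrow> (nat \<Rightarrow> real measure) \<Rightarrow> bool" where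
  "supports_NCD_joint_mix n F \<longleftrightarrow>
     (\<exists>(M :: (nat \<Rightarrow> real) measure) X. joint_mix_with_marginals n F M X \<and> NCD n M X)"

definition supports_NA_joint_mix :: "nat \<Rightarrow> (nat \<Rightarrow> real measure) \<Rightarrow> bool" where
  "supports_NA_joint_mix n F \<longleftrightarrow>
     (\<exists>(M :: (nat \<Rightarrow> real) measure) X. joint_mix_with_marginals n F M X \<and> NA n M X)"

definition vector_law :: "nat \<Rightarrow> 'a measure \<Rightarrow> (nat \<Rightarrow> 'a \<Rightarrow> real) \<Rightarrow> (nat \<Rightarrow> real) measure" where
  "vector_law n M X = distr M (PiM {1..n} (\<lambda>_. borel)) (subvector X {1..n})"

abbreviation (input) coordinate :: "nat \<Rightarrow> (nat \<Rightarrow> real) \<Rightarrow> real" where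
  "coordinate i x \<equiv> x i"

lemma measurable_subvector:
  assumes "random_vector n M X"
  shows "subvector X {1..n} \<in> measurable M (PiM {1..n} (\<lambda>_. borel))"
  using assms unfolding subvector_def [abs_def] random_vector_def
  by (intro measurable_restrict) auto

lemma measurable_coordinate [measurable]:
  "i \<in> {1..n} \<Longrightarrow> coordinate i \<in> borel_measurable (PiM {1..n} (\<lambda>_. borel :: real measure))"
  by (rule measurable_component_singleton)

lemma random_vector_vector_law:
  assumes "random_vector n M X"
  shows "random_vector n (vector_law n M X) coordinate"
proof -
  interpret prob_space M using assms by (simp add: random_vector_def)
  have "prob_space (vector_law n M X)"
    unfolding vector_law_def by (rule prob_space_distr) (rule measurable_subvector [OF assms])
  then show ?thesis
    using measurable_coordinate by (auto simp: random_vector_def vector_law_def)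
qed

lemma distr_vector_law:
  assumes "random_vector n M X" "h \<in> borel_measurable (PiM {1..n} (\<lambda>_. borel :: real measure))"
  shows "distr (vector_law n M X) borel h = distr M borel (\<lambda>\<omega>. h (subvector X {1..n} \<omega>))"
  unfolding vector_law_def
  using distr_distr [OF assms(2) measurable_subvector [OF assms(1)]] by (simp add: comp_def)

lemma joint_mix_with_marginals_vector_law:
  assumes "joint_mix_with_marginals n F M X"
  shows "joint_mix_with_marginals n F (vector_law n M X) coordinate"
proof -
  have rv: "random_vector n M X"
    using assms by (simp add: joint_mix_with_marginals_def joint_mix_def)
  obtain c where c: "AE \<omega> in M. (\<Sum>i\<in>{1..n}. X i \<omega>) = c"
    using assms by (auto simp: joint_mix_with_marginals_def joint_mix_def)
  have "AE x in vector_law n M X. (\<Sum>i\<in>{1..n}. x i) = c"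
    unfolding vector_law_def
  proof (subst AE_distr_iff [OF measurable_subvector [OF rv]])
    show "AE \<omega> in M. (\<Sum>i\<in>{1..n}. subvector X {1..n} \<omega> i) = c"
      using c by (simp add: subvector_def)
  qed (measurable, auto)
  moreover have "distr (vector_law n M X) borel (coordinate i) = F i" if "i \<in> {1..n}" for i
    using that assms distr_vector_law [OF rv measurable_coordinate [OF that]]
    by (simp add: joint_mix_with_marginals_def subvector_def)
  ultimately show ?thesis
    using random_vector_vector_law [OF rv]
    by (auto simp: joint_mix_with_marginals_def joint_mix_def)
qed

lemma square_integrable_vector_law:
  assumes "random_vector n M X" "h \<in> borel_measurable (PiM {1..n} (\<lambda>_. borel :: real measure))"
  shows "square_integrable (vector_law n M X) h \<longleftrightarrow>
         square_integrable M (\<lambda>\<omega>. h (subvector X {1..n} \<omega>))"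
proof -
  note [measurable] = assms(2) measurable_subvector [OF assms(1)]
  have "(\<lambda>\<omega>. h (subvector X {1..n} \<omega>)) \<in> borel_measurable M" by measurable
  moreover have "h \<in> borel_measurable (vector_law n M X)"
    using assms(2) by (simp add: vector_law_def)
  ultimately show ?thesis
    unfolding square_integrable_def vector_law_def
    by (subst integrable_distr_eq [OF measurable_subvector [OF assms(1)]]) auto
qed

lemma covariance_vector_law:
  assumes "random_vector n M X"
    "h \<in> borel_measurable (PiM {1..n} (\<lambda>_. borel :: real measure))"
    "k \<in> borel_measurable (PiM {1..n} (\<lambda>_. borel :: real measure))"
  shows "covariance (vector_law n M X) h k =
         covariance M (\<lambda>\<omega>. h (subvector X {1..n} \<omega>)) (\<lambda>\<omega>. k (subvector X {1..n} \<omega>))"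
proof -
  note [measurable] = assms(2,3)
  note law = integral_distr [OF measurable_subvector [OF assms(1)]]
  show ?thesis
    unfolding covariance_def vector_law_def law [OF assms(2)] law [OF assms(3)]
    by (rule law) measurable
qed

lemma NCD_vector_law:
  assumes "NCD n M X"
  shows "NCD n (vector_law n M X) coordinate"
proof -
  have rv: "random_vector n M X" using assms by (simp add: NCD_def)
  show ?thesis
    using assms random_vector_vector_law [OF rv]
    by (auto simp: NCD_def square_integrable_vector_law [OF rv] covariance_vector_law [OF rv]
        measurable_coordinate subvector_def)
qed

lemma NA_vector_law:
  assumes "NA n M X"
  shows "NA n (vector_law n M X) coordinate"
proof -
  have rv: "random_vector n M X" using assms by (simp add: NA_def)
  have sub: "subvector coordinate A (subvector X {1..n} \<omega>) = subvector X A \<omega>"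
    if "A \<subseteq> {1..n}" for A \<omega>
    using that by (auto simp: subvector_def fun_eq_iff restrict_def)
  have meas: "h \<in> borel_measurable (PiM {1..n} (\<lambda>_. borel))"
    if "square_integrable (vector_law n M X) h" for h
    using that by (simp add: square_integrable_def vector_law_def)
  show ?thesis
    unfolding NA_def
  proof (intro conjI allI impI)
    fix A B and f g :: "(nat \<Rightarrow> real) \<Rightarrow> real"
    let ?f = "\<lambda>x. f (subvector coordinate A x)" and ?g = "\<lambda>x. g (subvector coordinate B x)"
    assume AB: "A \<subseteq> {1..n}" "B \<subseteq> {1..n}" "A \<inter> B = {}"
      and mono: "mono_on (A \<rightarrow>\<^sub>E UNIV) f" "mono_on (B \<rightarrow>\<^sub>E UNIV) g"
      and f: "square_integrable (vector_law n M X) ?f"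
      and g: "square_integrable (vector_law n M X) ?g"
    have "square_integrable M (\<lambda>\<omega>. f (subvector X A \<omega>))"
      using f square_integrable_vector_law [OF rv meas [OF f]] by (simp only: sub [OF AB(1)])
    moreover have "square_integrable M (\<lambda>\<omega>. g (subvector X B \<omega>))"
      using g square_integrable_vector_law [OF rv meas [OF g]] by (simp only: sub [OF AB(2)])
    ultimately show "covariance (vector_law n M X) ?f ?g \<le> 0"
      using assms AB mono covariance_vector_law [OF rv meas [OF f] meas [OF g]]
      unfolding NA_def by (simp only: sub [OF AB(1)] sub [OF AB(2)])
  qed (rule random_vector_vector_law [OF rv])
qed

lemma gaussian_vector_vector_law:
  assumes "gaussian_vector n M X"
  shows "gaussian_vector n (vector_law n M X) coordinate"
proof -
  have rv: "random_vector n M X" using assms by (simp add: gaussian_vector_def)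
  have "distr (vector_law n M X) borel (\<lambda>x. \<Sum>i\<in>{1..n}. a i * x i) =
        distr M borel (\<lambda>\<omega>. \<Sum>i\<in>{1..n}. a i * X i \<omega>)" for a :: "nat \<Rightarrow> real"
    by (subst distr_vector_law [OF rv]) (measurable, simp add: subvector_def)
  then show ?thesis
    using assms random_vector_vector_law [OF rv] by (simp add: gaussian_vector_def)
qed

lemma supports_NCD_joint_mixI:
  "joint_mix_with_marginals n F M X \<Longrightarrow> NCD n M X \<Longrightarrow> supports_NCD_joint_mix n F"
  unfolding supports_NCD_joint_mix_def
  using joint_mix_with_marginals_vector_law NCD_vector_law by blast

lemma supports_NA_joint_mixI:
  "joint_mix_with_marginals n F M X \<Longrightarrow> NA n M X \<Longrightarrow> supports_NA_joint_mix n F"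
  unfolding supports_NA_joint_mix_def
  using joint_mix_with_marginals_vector_law NA_vector_law by blast

end

theory Submission
  imports Defs
begin

text \<open>
  In an NCD joint mix each \<open>X\<^sub>k\<close> is almost surely a constant minus the sum of the others, so its
  variance is at most the sum of their variances. Conversely, the inequality allows to split the
  variances into pair weights: \<open>\<sigma>\<^sub>i\<^sup>2 = \<Sum>\<^sub>j (w\<^sub>i\<^sub>j + w\<^sub>j\<^sub>i)\<close> with \<open>w \<ge> 0\<close> and \<open>w\<^sub>i\<^sub>i = 0\<close>. Take an independent
  standard normal \<open>Z\<^sub>p\<^sub>q\<close> for every pair, and add \<open>\<surd>w\<^sub>p\<^sub>q Z\<^sub>p\<^sub>q\<close> to coordinate \<open>p\<close> and subtract it from
  coordinate \<open>q\<close>. The sum of the coordinates is constant, and every \<open>Z\<^sub>p\<^sub>q\<close> drives at most two coordinates,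
  in opposite directions. Hence functions \<open>f(X\<^sub>A)\<close> and \<open>g(X\<^sub>B)\<close> of disjoint blocks are never monotone in the
  same direction in a \<open>Z\<^sub>p\<^sub>q\<close> on which both depend, and Chebyshev's association inequality, applied
  to one \<open>Z\<^sub>p\<^sub>q\<close> after another, gives negative association.
\<close>

section \<open>Chebyshev's association inequality\<close>

lemma integral_nonpos_AE:
  fixes f :: "'a \<Rightarrow> real"
  assumes "AE x in M. f x \<le> 0"
  shows "integral\<^sup>L M f \<le> 0"
  using integral_nonneg_AE [of "\<lambda>x. - f x" M] assms by auto

text \<open>For independent copies \<open>s\<close> and \<open>t\<close>, the product of increments
  has twice the covariance as its expectation. Integrating over \<open>t\<close> and then over
  \<open>s\<close> gives this without a product measure.\<close>

lemma (in prob_space) expectation_mult_le_of_opposite: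
  fixes f g :: "'a \<Rightarrow> real"
  assumes int: "integrable M f" "integrable M g" "integrable M (\<lambda>x. f x * g x)"
    and opp: "\<And>s t. s \<in> space M \<Longrightarrow> t \<in> space M \<Longrightarrow> (f s - f t) * (g s - g t) \<le> 0"
  shows "expectation (\<lambda>x. f x * g x) \<le> expectation f * expectation g"
proof -
  note [simp] = int
  let ?f = "expectation f" and ?g = "expectation g" and ?fg = "expectation (\<lambda>x. f x * g x)"
  have "f s * g s - f s * ?g - g s * ?f + ?fg \<le> 0" if s: "s \<in> space M" for s
  proof -
    have "f s * g s - f s * ?g - g s * ?f + ?fg =
        expectation (\<lambda>t. f s * g s - f s * g t - g s * f t + f t * g t)"
      by (simp add: prob_space)
    also have "\<dots> = expectation (\<lambda>t. (f s - f t) * (g s - g t))"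
      by (simp add: algebra_simps)
    also have "\<dots> \<le> 0"
      by (rule integral_nonpos_AE) (use opp s in auto)
    finally show ?thesis .
  qed
  then have "expectation (\<lambda>s. f s * g s - f s * ?g - g s * ?f + ?fg) \<le> 0"
    by (intro integral_nonpos_AE) auto
  then show ?thesis
    by (simp add: prob_space algebra_simps)
qed

text \<open>Integrate over \<open>t\<close> first, then over \<open>s\<close>. With increments for
  \<open>a\<close> and \<open>b\<close>, this is how opposite monotonicity survives averaging over a
  coordinate.\<close>

lemma (in prob_space) expectation_mult_nonpos:
  fixes a b :: "'a \<Rightarrow> real"
  assumes "integrable M a" "integrable M b"
    and "\<And>s t. s \<in> space M \<Longrightarrow> t \<in> space M \<Longrightarrow> a s * b t \<le> 0"
  shows "expectation a * expectation b \<le> 0"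
proof -
  have "a s * expectation b \<le> 0" if "s \<in> space M" for s
    using integral_nonpos_AE [of "\<lambda>t. a s * b t" M] assms that by auto
  then have "expectation (\<lambda>s. a s * expectation b) \<le> 0"
    by (intro integral_nonpos_AE) auto
  then show ?thesis by simp
qed

section \<open>Oppositely monotone functions on finite products\<close>

text \<open>The base points \<open>x\<close> and \<open>y\<close> are independent of each other, so for every coordinate \<open>e\<close> one of the
  two functions is constant in \<open>e\<close>, or one is increasing and the other decreasing in \<open>e\<close>. As an
  inequality between products of increments, the condition survives integrating out a coordinate
  and clamping.\<close>

definition oppositely_monotone ::
    "'i set \<Rightarrow> ('i \<Rightarrow> 'a measure) \<Rightarrow> (('i \<Rightarrow> 'a) \<Rightarrow> real) \<Rightarrow> (('i \<Rightarrow> 'a) \<Rightarrow> real) \<Rightarrow> bool" where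
  "oppositely_monotone I M f g \<longleftrightarrow>
     (\<forall>e\<in>I. \<forall>x\<in>space (PiM I M). \<forall>y\<in>space (PiM I M). \<forall>s\<in>space (M e). \<forall>t\<in>space (M e).
        (f (x(e := s)) - f (x(e := t))) * (g (y(e := s)) - g (y(e := t))) \<le> 0)"

lemma oppositely_monotoneD:
  assumes "oppositely_monotone I M f g" "e \<in> I" "x \<in> space (PiM I M)" "y \<in> space (PiM I M)"
    "s \<in> space (M e)" "t \<in> space (M e)"
  shows "(f (x(e := s)) - f (x(e := t))) * (g (y(e := s)) - g (y(e := t))) \<le> 0"
  using assms unfolding oppositely_monotone_def by blast

lemma fun_upd_in_space_PiM:
  "x \<in> space (PiM I M) \<Longrightarrow> y \<in> space (M i) \<Longrightarrow> x(i := y) \<in> space (PiM (insert i I) M)"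
  by (auto simp: space_PiM PiE_def extensional_def Pi_iff)

text \<open>Induction on \<open>I\<close>: Chebyshev's inequality handles one coordinate with the
  others fixed, and the averages over that coordinate fall to the induction hypothesis. Boundedness
  makes every section integrable, not just almost every one, which suits a pointwise monotonicity
  condition.\<close>

lemma expectation_mult_le_of_oppositely_monotone_bounded:
  fixes M :: "'i \<Rightarrow> 'a measure" and f g :: "('i \<Rightarrow> 'a) \<Rightarrow> real"
  assumes prob: "\<And>i. prob_space (M i)" and "finite I"
    and "f \<in> borel_measurable (PiM I M)" "g \<in> borel_measurable (PiM I M)"
    and "\<And>x. x \<in> space (PiM I M) \<Longrightarrow> \<bar>f x\<bar> \<le> K" "\<And>x. x \<in> space (PiM I M) \<Longrightarrow> \<bar>g x\<bar> \<le> K"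
    and "oppositely_monotone I M f g"
  shows "(\<integral>x. f x * g x \<partial>PiM I M) \<le> (\<integral>x. f x \<partial>PiM I M) * (\<integral>x. g x \<partial>PiM I M)"
  using assms(2-)
proof (induction I arbitrary: f g rule: finite_induct)
  case empty
  show ?case
    by (simp add: PiM_empty lebesgue_integral_count_space_finite)
next
  case (insert i I)
  interpret product_prob_space M I by (rule product_prob_spaceI) (rule prob)
  interpret Q: prob_space "PiM (insert i I) M" by (rule prob_space_PiM) (rule prob)
  note [measurable] = insert.prems(1,2)
  note upd = fun_upd_in_space_PiM
  have K: "K \<ge> 0"
    using insert.prems(3) Q.not_empty by (meson abs_ge_zero ex_in_conv order_trans)
  have bounded: "\<bar>f x * g x\<bar> \<le> K * K" if "x \<in> space (PiM (insert i I) M)" for x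
    unfolding abs_mult using insert.prems(3,4) that K by (intro mult_mono) auto
  have int: "integrable (PiM (insert i I) M) f" "integrable (PiM (insert i I) M) g"
    "integrable (PiM (insert i I) M) (\<lambda>x. f x * g x)"
    using insert.prems(3,4) bounded
    by (auto intro!: Q.integrable_const_bound AE_I2)
  \<comment> \<open>The conditional expectation of \<open>h\<close> given the coordinates in
    \<open>I\<close>.\<close>
  define F where "F h x = (\<integral>y. h (x(i := y)) \<partial>M i)" for h :: "('i \<Rightarrow> 'a) \<Rightarrow> real" and x
  have section_integrable: "integrable (M i) (\<lambda>y. h (x(i := y)))"
    if "h \<in> borel_measurable (PiM (insert i I) M)" "x \<in> space (PiM I M)"
      "\<And>x. x \<in> space (PiM (insert i I) M) \<Longrightarrow> \<bar>h x\<bar> \<le> C" for h :: "('i \<Rightarrow> 'a) \<Rightarrow> real" and x C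
  proof (rule M.integrable_const_bound [where B = C])
    show "AE y in M i. norm (h (x(i := y))) \<le> C"
      using that(3) [OF upd [OF that(2)]] by (intro AE_I2) auto
    show "(\<lambda>y. h (x(i := y))) \<in> borel_measurable (M i)"
      using measurable_comp [OF measurable_component_update [OF that(2) insert.hyps(2)] that(1)]
      by (simp add: comp_def)
  qed
  have F_meas: "F h \<in> borel_measurable (PiM I M)"
    if [measurable]: "h \<in> borel_measurable (PiM (insert i I) M)" for h
    unfolding F_def by measurable
  have F_bound: "\<bar>F h x\<bar> \<le> C" if "h \<in> borel_measurable (PiM (insert i I) M)" "x \<in> space (PiM I M)"
      "\<And>x. x \<in> space (PiM (insert i I) M) \<Longrightarrow> \<bar>h x\<bar> \<le> C" for h x C
  proof -
    have "\<bar>F h x\<bar> \<le> (\<integral>y. C \<partial>M i)"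
      unfolding F_def using that(3) [OF upd [OF that(2)]] section_integrable [OF that]
      by (intro order_trans [OF integral_abs_bound] integral_mono) auto
    then show ?thesis by (simp add: M.prob_space)
  qed
  have F_opp: "oppositely_monotone I M (F f) (F g)"
    unfolding oppositely_monotone_def
  proof (intro ballI)
    fix e x y s t
    assume e: "e \<in> I" and x: "x \<in> space (PiM I M)" and y: "y \<in> space (PiM I M)"
      and st: "s \<in> space (M e)" "t \<in> space (M e)"
    have sp: "z(e := r) \<in> space (PiM I M)" if "z \<in> space (PiM I M)" "r \<in> space (M e)" for z r
      using upd [OF that] e by (simp add: insert_absorb)
    have ne: "i \<noteq> e" using e insert.hyps by auto
    note sf = section_integrable [OF insert.prems(1) _ insert.prems(3)]
      and sg = section_integrable [OF insert.prems(2) _ insert.prems(4)]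
    have "(\<integral>u. f (x(e := s, i := u)) - f (x(e := t, i := u)) \<partial>M i) *
          (\<integral>u. g (y(e := s, i := u)) - g (y(e := t, i := u)) \<partial>M i) \<le> 0"
    proof (rule M.expectation_mult_nonpos)
      show "integrable (M i) (\<lambda>u. f (x(e := s, i := u)) - f (x(e := t, i := u)))"
        using st by (intro Bochner_Integration.integrable_diff sf sp x)
      show "integrable (M i) (\<lambda>u. g (y(e := s, i := u)) - g (y(e := t, i := u)))"
        using st by (intro Bochner_Integration.integrable_diff sg sp y)
      \<comment> \<open>Independent base points are used here: the sections of \<open>f\<close> and
        \<open>g\<close> carry different values \<open>u\<close> and \<open>v\<close> at
        \<open>i\<close>.\<close>
      fix u v assume uv: "u \<in> space (M i)" "v \<in> space (M i)"
      show "(f (x(e := s, i := u)) - f (x(e := t, i := u))) *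
            (g (y(e := s, i := v)) - g (y(e := t, i := v))) \<le> 0"
        using oppositely_monotoneD [OF insert.prems(5) insertI2 [OF e] upd [OF x uv(1)] upd [OF y uv(2)] st]
        by (simp only: fun_upd_twist [OF ne])
    qed
    then show "(F f (x(e := s)) - F f (x(e := t))) * (F g (y(e := s)) - F g (y(e := t))) \<le> 0"
      unfolding F_def using sf sg sp x y st by simp
  qed
  have "(\<integral>x. f x * g x \<partial>PiM (insert i I) M) = (\<integral>x. F (\<lambda>x. f x * g x) x \<partial>PiM I M)"
    unfolding F_def by (rule product_integral_insert [OF insert.hyps int(3)])
  also have "\<dots> \<le> (\<integral>x. F f x * F g x \<partial>PiM I M)"
  proof (rule integral_mono)
    have b: "\<bar>F f x * F g x\<bar> \<le> K * K" if "x \<in> space (PiM I M)" for x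
      unfolding abs_mult using F_bound insert.prems that K by (intro mult_mono) auto
    show "integrable (PiM I M) (\<lambda>x. F f x * F g x)"
      using b F_meas insert.prems by (intro P.integrable_const_bound [where B = "K * K"] AE_I2) auto
    have "\<bar>F (\<lambda>x. f x * g x) x\<bar> \<le> K * K" if "x \<in> space (PiM I M)" for x
      by (rule F_bound [OF _ that bounded]) measurable
    then show "integrable (PiM I M) (F (\<lambda>x. f x * g x))"
      using F_meas by (intro P.integrable_const_bound [where B = "K * K"] AE_I2) auto
    fix x assume x: "x \<in> space (PiM I M)"
    show "F (\<lambda>x. f x * g x) x \<le> F f x * F g x"
      unfolding F_def
    proof (rule M.expectation_mult_le_of_opposite)
      fix s t assume st: "s \<in> space (M i)" "t \<in> space (M i)"
      show "(f (x(i := s)) - f (x(i := t))) * (g (x(i := s)) - g (x(i := t))) \<le> 0"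
        \<comment> \<open>The base point only has to lie in the larger product; the value of
          \<open>x(i := s)\<close> at \<open>i\<close> is overwritten.\<close>
        using oppositely_monotoneD [OF insert.prems(5) insertI1 upd [OF x st(1)] upd [OF x st(1)] st]
        by (simp only: fun_upd_upd)
    next
      show "integrable (M i) (\<lambda>y. f (x(i := y)))" "integrable (M i) (\<lambda>y. g (x(i := y)))"
        using section_integrable [OF insert.prems(1) x insert.prems(3)]
          section_integrable [OF insert.prems(2) x insert.prems(4)] by blast+
      show "integrable (M i) (\<lambda>y. f (x(i := y)) * g (x(i := y)))"
        by (rule section_integrable [OF _ x bounded]) measurable
    qed
  qed
  also have "\<dots> \<le> (\<integral>x. F f x \<partial>PiM I M) * (\<integral>x. F g x \<partial>PiM I M)"
    using insert.prems by (intro insert.IH F_meas F_bound F_opp) auto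
  also have "(\<integral>x. F f x \<partial>PiM I M) = (\<integral>x. f x \<partial>PiM (insert i I) M)"
    unfolding F_def by (rule product_integral_insert [OF insert.hyps int(1), symmetric])
  also have "(\<integral>x. F g x \<partial>PiM I M) = (\<integral>x. g x \<partial>PiM (insert i I) M)"
    unfolding F_def by (rule product_integral_insert [OF insert.hyps int(2), symmetric])
  finally show ?case .
qed

section \<open>Truncation: from bounded to square integrable functions\<close>

definition clamp_real :: "real \<Rightarrow> real \<Rightarrow> real" where
  "clamp_real k x = max (- k) (min x k)"

text \<open>Clamping is nondecreasing, so it may shrink an increment to 0 but cannot reverse its
  sign.\<close>

lemma clamp_real_opposite:
  assumes "(a - b) * (c - d) \<le> 0"
  shows "(clamp_real k a - clamp_real k b) * (clamp_real k c - clamp_real k d) \<le> 0"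
  using assms unfolding mult_le_0_iff clamp_real_def by (auto simp: max_def min_def)

lemma abs_clamp_real_le: "0 \<le> k \<Longrightarrow> \<bar>clamp_real k x\<bar> \<le> \<bar>x\<bar>" "0 \<le> k \<Longrightarrow> \<bar>clamp_real k x\<bar> \<le> k"
  by (auto simp: clamp_real_def)

lemma clamp_real_tendsto: "(\<lambda>k. clamp_real (real k) x) \<longlonglongrightarrow> x"
proof (rule tendsto_eventually)
  have "\<forall>\<^sub>F k in sequentially. \<bar>x\<bar> \<le> real k"
    using filterlim_real_sequentially by (auto simp: filterlim_at_top)
  then show "\<forall>\<^sub>F k in sequentially. clamp_real (real k) x = x"
    by eventually_elim (auto simp: clamp_real_def)
qed

lemma measurable_clamp_real [measurable]: "clamp_real k \<in> borel_measurable borel"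
  unfolding clamp_real_def [abs_def] by measurable

lemma square_integrable_mult:
  assumes "square_integrable M f" "square_integrable M g"
  shows "integrable M (\<lambda>x. f x * g x)"
proof (rule Bochner_Integration.integrable_bound)
  show "integrable M (\<lambda>x. (f x)\<^sup>2 + (g x)\<^sup>2)"
    using assms by (auto simp: square_integrable_def)
  show "(\<lambda>x. f x * g x) \<in> borel_measurable M"
    using assms by (auto simp: square_integrable_def)
  have "\<bar>a * b\<bar> \<le> a\<^sup>2 + b\<^sup>2" for a b :: real
    using sum_squares_bound [of "\<bar>a\<bar>" "\<bar>b\<bar>"] mult_nonneg_nonneg [of "\<bar>a\<bar>" "\<bar>b\<bar>"]
    unfolding abs_mult power2_abs by linarith
  then show "AE x in M. norm (f x * g x) \<le> norm ((f x)\<^sup>2 + (g x)\<^sup>2)"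
    by simp
qed

lemma (in prob_space) square_integrable_integrable:
  "square_integrable M f \<Longrightarrow> integrable M f"
  unfolding square_integrable_def by (blast intro: square_integrable_imp_integrable)

lemma (in prob_space) covariance_eq:
  assumes "square_integrable M f" "square_integrable M g"
  shows "covariance M f g = expectation (\<lambda>x. f x * g x) - expectation f * expectation g"
  using square_integrable_integrable [OF assms(1)] square_integrable_integrable [OF assms(2)]
    square_integrable_mult [OF assms]
  by (simp add: covariance_def algebra_simps prob_space)

text \<open>Clamp both functions to \<open>[-k, k]\<close>, apply the bounded case and let
  \<open>k\<close> tend to infinity. The absolute values of \<open>f\<close>, \<open>g\<close> and
  their product dominate; square integrability makes them integrable.\<close>

lemma covariance_nonpos_of_oppositely_monotone:
  fixes M :: "'i \<Rightarrow> 'a measure" and f g :: "('i \<Rightarrow> 'a) \<Rightarrow> real"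
  assumes prob: "\<And>i. prob_space (M i)" and "finite I"
    and sq: "square_integrable (PiM I M) f" "square_integrable (PiM I M) g"
    and opp: "oppositely_monotone I M f g"
  shows "covariance (PiM I M) f g \<le> 0"
proof -
  let ?P = "PiM I M"
  interpret prob_space ?P by (rule prob_space_PiM) (rule prob)
  have [measurable]: "f \<in> borel_measurable ?P" "g \<in> borel_measurable ?P"
    using sq by (auto simp: square_integrable_def)
  let ?c = "\<lambda>k. clamp_real (real k)"
  have bound: "expectation (\<lambda>x. ?c k (f x) * ?c k (g x)) \<le>
      expectation (\<lambda>x. ?c k (f x)) * expectation (\<lambda>x. ?c k (g x))" for k
    by (rule expectation_mult_le_of_oppositely_monotone_bounded [where K = k])
       (use prob \<open>finite I\<close> opp in \<open>auto simp: oppositely_monotone_def abs_clamp_real_le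
          intro!: clamp_real_opposite\<close>)
  have lim1: "(\<lambda>k. expectation (\<lambda>x. ?c k (h x))) \<longlonglongrightarrow> expectation h"
    if "square_integrable ?P h" for h
  proof (rule integral_dominated_convergence [where w = "\<lambda>x. \<bar>h x\<bar>"])
    have [measurable]: "h \<in> borel_measurable ?P"
      using that by (auto simp: square_integrable_def)
    show "h \<in> borel_measurable ?P" "\<And>k. (\<lambda>x. ?c k (h x)) \<in> borel_measurable ?P"
      by measurable
  qed (use square_integrable_integrable [OF that] in
      \<open>auto simp: abs_clamp_real_le clamp_real_tendsto\<close>)
  have "(\<lambda>k. expectation (\<lambda>x. ?c k (f x) * ?c k (g x))) \<longlonglongrightarrow> expectation (\<lambda>x. f x * g x)"
  proof (rule integral_dominated_convergence [where w = "\<lambda>x. \<bar>f x * g x\<bar>"])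
    show "AE x in ?P. (\<lambda>k. ?c k (f x) * ?c k (g x)) \<longlonglongrightarrow> f x * g x"
      by (intro AE_I2 tendsto_mult clamp_real_tendsto)
    show "AE x in ?P. norm (?c k (f x) * ?c k (g x)) \<le> \<bar>f x * g x\<bar>" for k
      by (auto simp: abs_mult abs_clamp_real_le intro!: mult_mono)
  qed (use square_integrable_mult [OF sq] in auto)
  then have "expectation (\<lambda>x. f x * g x) \<le> expectation f * expectation g"
    by (rule LIMSEQ_le [OF _ tendsto_mult [OF lim1 [OF sq(1)] lim1 [OF sq(2)]]]) (use bound in auto)
  then show ?thesis
    by (simp add: covariance_eq [OF sq])
qed

section \<open>Negative association of linear images\<close>

lemma mono_on_subvector_le:
  assumes "mono_on (A \<rightarrow>\<^sub>E UNIV) f" "\<And>i. i \<in> A \<Longrightarrow> X i \<omega> \<le> Y i \<omega>'"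
  shows "f (subvector X A \<omega>) \<le> f (subvector Y A \<omega>')"
  by (rule mono_onD [OF assms(1)]) (use assms(2) in \<open>auto simp: subvector_def le_fun_def\<close>)

text \<open>By \<open>neg\<close>, a change of \<open>z e\<close> never moves coordinates from
  disjoint blocks in the same direction. Increasing functions of the two blocks are therefore
  oppositely monotone in the independent variables.\<close>

lemma NA_independent_linear:
  fixes N :: "'e \<Rightarrow> real measure" and c :: "nat \<Rightarrow> 'e \<Rightarrow> real" and m :: "nat \<Rightarrow> real"
  assumes prob: "\<And>e. prob_space (N e)" and sets_N: "\<And>e. sets (N e) = sets borel" and "finite E"
    and neg: "\<And>i j e. i \<in> {1..n} \<Longrightarrow> j \<in> {1..n} \<Longrightarrow> i \<noteq> j \<Longrightarrow> e \<in> E \<Longrightarrow> c i e * c j e \<le> 0"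
  defines "X \<equiv> \<lambda>i z. m i + (\<Sum>e\<in>E. c i e * z e)"
  shows "NA n (PiM E N) X"
  unfolding NA_def
proof (intro conjI allI impI)
  have comp: "(\<lambda>z. z e) \<in> borel_measurable (PiM E N)" if "e \<in> E" for e
    using measurable_component_singleton [OF that, of N]
    by (simp add: measurable_cong_sets [OF refl sets_N])
  have "X i \<in> borel_measurable (PiM E N)" for i
    unfolding X_def by (intro borel_measurable_add borel_measurable_sum borel_measurable_times comp) auto
  then show "random_vector n (PiM E N) X"
    by (simp add: random_vector_def prob_space_PiM prob)
  fix A B and f g :: "(nat \<Rightarrow> real) \<Rightarrow> real"
  assume AB: "A \<subseteq> {1..n}" "B \<subseteq> {1..n}" "A \<inter> B = {}"
    and mono: "mono_on (A \<rightarrow>\<^sub>E UNIV) f" "mono_on (B \<rightarrow>\<^sub>E UNIV) g"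
    and sq: "square_integrable (PiM E N) (\<lambda>\<omega>. f (subvector X A \<omega>))"
      "square_integrable (PiM E N) (\<lambda>\<omega>. g (subvector X B \<omega>))"
  show "covariance (PiM E N) (\<lambda>\<omega>. f (subvector X A \<omega>)) (\<lambda>\<omega>. g (subvector X B \<omega>)) \<le> 0"
  proof (rule covariance_nonpos_of_oppositely_monotone [OF prob \<open>finite E\<close> sq])
    show "oppositely_monotone E N (\<lambda>\<omega>. f (subvector X A \<omega>)) (\<lambda>\<omega>. g (subvector X B \<omega>))"
      unfolding oppositely_monotone_def
    proof (intro ballI)
      fix e x y s t
      assume e: "e \<in> E"
      let ?f = "\<lambda>r. f (subvector X A (x(e := r)))" and ?g = "\<lambda>r. g (subvector X B (y(e := r)))"
      have X_upd: "X i (z(e := r)) = c i e * r + (m i + (\<Sum>e'\<in>E - {e}. c i e' * z e'))" for i z r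
        unfolding X_def using e \<open>finite E\<close>
        by (subst sum.remove [of _ e]) (auto intro!: sum.cong)
      have up: "h (subvector X C (z(e := r))) \<le> h (subvector X C (z(e := r')))"
        if "mono_on (C \<rightarrow>\<^sub>E UNIV) h" "\<And>i. i \<in> C \<Longrightarrow> c i e * r \<le> c i e * r'" for C z r r' and h :: "(nat \<Rightarrow> real) \<Rightarrow> real"
        by (rule mono_on_subvector_le [OF that(1)]) (use that(2) in \<open>auto simp: X_upd\<close>)
      have flat: "h (subvector X C (z(e := r))) = h (subvector X C (z(e := r')))"
        if "mono_on (C \<rightarrow>\<^sub>E UNIV) h" "\<And>i. i \<in> C \<Longrightarrow> c i e = 0" for C z r r' and h :: "(nat \<Rightarrow> real) \<Rightarrow> real"
        by (rule antisym; rule up [OF that(1)]) (use that(2) in auto)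
      have sign: "c i e * c j e \<le> 0" if "i \<in> A" "j \<in> B" for i j
        using AB that by (intro neg [OF _ _ _ e]) auto
      \<comment> \<open>If neither block vanishes at \<open>e\<close>, a nonzero coefficient in one
        block fixes the sign of the whole other block, and conversely.\<close>
      consider "\<forall>i\<in>A. c i e = 0" | "\<forall>j\<in>B. c j e = 0"
        | "\<forall>i\<in>A. 0 \<le> c i e" "\<forall>j\<in>B. c j e \<le> 0" | "\<forall>i\<in>A. c i e \<le> 0" "\<forall>j\<in>B. 0 \<le> c j e"
        using sign unfolding mult_le_0_iff by (metis order.antisym)
      then show "(?f s - ?f t) * (?g s - ?g t) \<le> 0"
      proof cases
        case 1
        then have "?f s = ?f t" using flat [OF mono(1)] by blast
        then show ?thesis by simp
      next
        case 2
        then have "?g s = ?g t" using flat [OF mono(2)] by blast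
        then show ?thesis by simp
      next
        case 3
        then have "r \<le> r' \<Longrightarrow> ?f r \<le> ?f r'" "r \<le> r' \<Longrightarrow> ?g r' \<le> ?g r" for r r'
          by (auto intro!: up [OF mono(1)] up [OF mono(2)] intro: mult_left_mono mult_left_mono_neg)
        then show ?thesis
          using linear [of s t] unfolding mult_le_0_iff diff_ge_0_iff_ge diff_le_0_iff_le by blast
      next
        case 4
        then have "r \<le> r' \<Longrightarrow> ?f r' \<le> ?f r" "r \<le> r' \<Longrightarrow> ?g r \<le> ?g r'" for r r'
          by (auto intro!: up [OF mono(1)] up [OF mono(2)] intro: mult_left_mono mult_left_mono_neg)
        then show ?thesis
          using linear [of s t] unfolding mult_le_0_iff diff_ge_0_iff_ge diff_le_0_iff_le by blast
      qed
    qed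
  qed
qed

text \<open>Coordinates are increasing functions of singleton blocks. Their second moments are
  assumed, since \<open>NA\<close> only constrains functions that have them.\<close>

lemma NA_imp_NCD:
  assumes "NA n M X" "\<And>i. i \<in> {1..n} \<Longrightarrow> square_integrable M (X i)"
  shows "NCD n M X"
  unfolding NCD_def
proof (intro conjI ballI impI)
  show "random_vector n M X" using assms by (simp add: NA_def)
  fix i j assume ij: "i \<in> {1..n}" "j \<in> {1..n}" "i \<noteq> j"
  have "covariance M (\<lambda>\<omega>. coordinate i (subvector X {i} \<omega>)) (\<lambda>\<omega>. coordinate j (subvector X {j} \<omega>)) \<le> 0"
    using assms(1) unfolding NA_def
    by (elim conjE allE [of _ "{i}"] allE [of _ "{j}"] allE [of _ "coordinate i"] allE [of _ "coordinate j"])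
       (use ij assms(2) in \<open>auto simp: mono_on_def le_fun_def subvector_def\<close>)
  then show "covariance M (X i) (X j) \<le> 0" by (simp add: subvector_def)
qed (use assms in auto)

section \<open>Gaussian moments and necessity of the inequality\<close>

lemma (in prob_space) gaussian_moments:
  assumes [measurable]: "X \<in> borel_measurable M"
    and law: "distr M borel X = gaussian m s" and "0 \<le> s"
  shows "square_integrable M X" "covariance M X X = s\<^sup>2"
proof -
  have "integrable (distr M borel X) (\<lambda>x. x\<^sup>2) \<and> covariance M X X = s\<^sup>2"
  proof (cases "s = 0")
    case True
    have E: "expectation (\<lambda>\<omega>. h (X \<omega>)) = h m" if [measurable]: "h \<in> borel_measurable borel"
      for h :: "real \<Rightarrow> real"
      using integral_distr [of X M borel h] law True by (simp add: gaussian_def integral_return)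
    have "expectation X = m" using E [of "\<lambda>x. x"] by simp
    then have "covariance M X X = 0"
      using E [of "\<lambda>x. (x - m) * (x - m)"] by (simp add: covariance_def)
    moreover have "integrable (distr M borel X) (\<lambda>x. x\<^sup>2)"
      unfolding law using True
      by (auto simp: gaussian_def integrable_iff_bounded nn_integral_return)
    ultimately show ?thesis using True by simp
  next
    case False
    with \<open>0 \<le> s\<close> have s: "0 < s" by simp
    have D: "distributed M lborel X (normal_density m s)"
      using law s by (auto simp: distributed_def gaussian_def cong: distr_cong)
    \<comment> \<open>The second moment is recovered from the centred one:
      \<open>(x - m)^2 + 2 * m * x - m^2 = x^2\<close>.\<close>
    have "integrable lborel (\<lambda>x. normal_density m s x * (x - m)^2
        + 2 * m * (normal_density m s x * x) - m\<^sup>2 * normal_density m s x)"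
      using s by (auto intro!: Bochner_Integration.integrable_add Bochner_Integration.integrable_diff
          integrable_normal_moment integrable_normal_moment_nz_1)
    then have "integrable lborel (\<lambda>x. normal_density m s x * x\<^sup>2)"
      by (simp add: power2_eq_square algebra_simps)
    then have "integrable (distr M borel X) (\<lambda>x. x\<^sup>2)"
      unfolding law using s by (simp add: gaussian_def integrable_density)
    moreover have "covariance M X X = s\<^sup>2"
      using normal_distributed_variance [OF s D] by (simp add: covariance_def power2_eq_square)
    ultimately show ?thesis by simp
  qed
  then show "square_integrable M X" "covariance M X X = s\<^sup>2"
    by (auto simp: square_integrable_def integrable_distr_eq)
qed

lemma (in prob_space) covariance_sum_right:
  assumes "finite J" "square_integrable M Y" "\<And>j. j \<in> J \<Longrightarrow> square_integrable M (X j)"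
  shows "square_integrable M (\<lambda>\<omega>. \<Sum>j\<in>J. X j \<omega>)"
    and "covariance M Y (\<lambda>\<omega>. \<Sum>j\<in>J. X j \<omega>) = (\<Sum>j\<in>J. covariance M Y (X j))"
proof -
  show sq: "square_integrable M (\<lambda>\<omega>. \<Sum>j\<in>J. X j \<omega>)"
    using assms(3) square_integrable_mult [OF assms(3) assms(3)]
    by (auto simp: square_integrable_def power2_eq_square sum_product)
  show "covariance M Y (\<lambda>\<omega>. \<Sum>j\<in>J. X j \<omega>) = (\<Sum>j\<in>J. covariance M Y (X j))"
    using assms square_integrable_mult [OF assms(2,3)] square_integrable_integrable [OF assms(3)]
    by (simp add: covariance_eq sq sum_distrib_left sum_subtractf Bochner_Integration.integral_sum)
qed

lemma covariance_commute: "covariance M X Y = covariance M Y X"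
  by (simp add: covariance_def mult.commute)

text \<open>The deviations of \<open>X\<close> and \<open>Y\<close> from their means are almost
  surely negatives of each other.\<close>

lemma (in prob_space) covariance_AE_affine:
  assumes "square_integrable M X" "square_integrable M Y" "AE \<omega> in M. X \<omega> + Y \<omega> = c"
  shows "covariance M X X = covariance M Y Y"
proof -
  note [measurable] = assms(1,2) [unfolded square_integrable_def, THEN conjunct1]
  note [simp] = assms(1,2) [THEN square_integrable_integrable]
  have eq: "AE \<omega> in M. X \<omega> = c - Y \<omega>"
    using assms(3) by eventually_elim auto
  have "expectation X = expectation (\<lambda>\<omega>. c - Y \<omega>)"
    using eq by (intro integral_cong_AE) auto
  then have "expectation X = c - expectation Y" by (simp add: prob_space)
  then have dev: "c - y - expectation X = - (y - expectation Y)" for y by simp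
  have "AE \<omega> in M. (X \<omega> - expectation X) * (X \<omega> - expectation X) =
      (Y \<omega> - expectation Y) * (Y \<omega> - expectation Y)"
    using eq by eventually_elim (simp only: dev minus_mult_minus)
  then show ?thesis
    unfolding covariance_def by (intro integral_cong_AE) auto
qed

lemma NCD_joint_mix_variance_le:
  assumes "joint_mix n M X" "NCD n M X" "k \<in> {1..n}"
  shows "covariance M (X k) (X k) \<le> (\<Sum>i\<in>{1..n} - {k}. covariance M (X i) (X i))"
proof -
  interpret prob_space M using assms by (simp add: joint_mix_def random_vector_def)
  let ?J = "{1..n} - {k}"
  have sq: "\<And>i. i \<in> {1..n} \<Longrightarrow> square_integrable M (X i)"
    and neg: "\<And>i j. i \<in> {1..n} \<Longrightarrow> j \<in> {1..n} \<Longrightarrow> i \<noteq> j \<Longrightarrow> covariance M (X i) (X j) \<le> 0"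
    using assms(2) by (auto simp: NCD_def)
  obtain c where c: "AE \<omega> in M. (\<Sum>i\<in>{1..n}. X i \<omega>) = c"
    using assms(1) by (auto simp: joint_mix_def)
  let ?S = "\<lambda>\<omega>. \<Sum>i\<in>?J. X i \<omega>"
  have sqS: "square_integrable M ?S"
    using sq assms(3) by (intro covariance_sum_right(1) [OF _ sq [OF assms(3)]]) auto
  have "covariance M (X k) (X k) = covariance M ?S ?S"
    using c assms(3) by (intro covariance_AE_affine [where c = c] sq sqS) (auto simp: sum.remove)
  also have "\<dots> = (\<Sum>i\<in>?J. covariance M (X i) ?S)"
    using sq sqS by (subst covariance_sum_right(2)) (auto simp: covariance_commute)
  also have "\<dots> \<le> (\<Sum>i\<in>?J. covariance M (X i) (X i))"
  proof (rule sum_mono)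
    fix i assume i: "i \<in> ?J"
    have "covariance M (X i) ?S = (\<Sum>j\<in>?J. covariance M (X i) (X j))"
      using sq i by (intro covariance_sum_right(2)) auto
    also have "\<dots> = covariance M (X i) (X i) + (\<Sum>j\<in>?J - {i}. covariance M (X i) (X j))"
      using i by (intro sum.remove) auto
    also have "\<dots> \<le> covariance M (X i) (X i)"
      using neg i by (auto intro!: sum_nonpos)
    finally show "covariance M (X i) ?S \<le> covariance M (X i) (X i)" .
  qed
  finally show ?thesis .
qed

section \<open>Linear combinations of independent normals\<close>

text \<open>Summands with zero coefficient have no density, so they are discarded before independent
  normals are added. If none remain, the law is the point mass at \<open>b\<close>, which is
  \<open>gaussian b 0\<close>.\<close>

lemma gaussian_linear_combination:
  fixes E :: "'e set" and d :: "'e \<Rightarrow> real"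
  assumes "finite E"
  shows "distr (PiM E (\<lambda>_. gaussian 0 1)) borel (\<lambda>z. b + (\<Sum>e\<in>E. d e * z e)) =
         gaussian b (sqrt (\<Sum>e\<in>E. (d e)\<^sup>2))"
proof -
  let ?N = "\<lambda>_ :: 'e. gaussian 0 1" and ?P = "PiM E (\<lambda>_. gaussian 0 1)"
  have N: "prob_space (?N e)" for e
    by (simp add: gaussian_def prob_space_normal_density)
  have "sets (gaussian 0 1) = sets borel"
    by (simp add: gaussian_def)
  interpret prob_space ?P by (rule prob_space_PiM) (rule N)
  let ?E = "{e\<in>E. d e \<noteq> 0}"
  have sum_eq: "(\<Sum>e\<in>E. d e * z e) = (\<Sum>e\<in>?E. d e * z e)" for z :: "'e \<Rightarrow> real"
    using \<open>finite E\<close> by (intro sum.mono_neutral_right) auto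
  have sq_eq: "(\<Sum>e\<in>E. (d e)\<^sup>2) = (\<Sum>e\<in>?E. \<bar>d e\<bar>\<^sup>2)"
    using \<open>finite E\<close> by (simp, intro sum.mono_neutral_right) auto
  show ?thesis
  proof (cases "?E = {}")
    case True
    then have "distr ?P borel (\<lambda>z. b + (\<Sum>e\<in>E. d e * z e)) = distr ?P borel (\<lambda>_. b)"
      unfolding sum_eq by simp
    also have "\<dots> = return borel b"
      by (rule measure_eqI) (auto simp: emeasure_distr emeasure_space_1 split: split_indicator)
    finally show ?thesis
      unfolding sq_eq using True by (simp add: gaussian_def)
  next
    case False
    have E: "E \<noteq> {}" using False by auto
    have coord: "distr ?P borel (\<lambda>z. z e) = gaussian 0 1" if "e \<in> E" for e
    proof -
      \<comment> \<open>Only the sigma-algebra of the target matters to \<open>distr\<close>; the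
        component law is stated with the factor itself as target.\<close>
      have "distr ?P borel (\<lambda>z. z e) = distr ?P (gaussian 0 1) (\<lambda>z. z e)"
        by (rule distr_cong) (simp_all add: gaussian_def)
      then show ?thesis
        using distr_PiM_component [of E ?N, OF N that] by simp
    qed
    have meas: "(\<lambda>z. z e) \<in> borel_measurable ?P" if "e \<in> E" for e
      using measurable_component_singleton [OF that, of ?N]
      by (simp only: measurable_cong_sets [OF refl \<open>sets (gaussian 0 1) = sets borel\<close>])
    have "indep_vars (\<lambda>_. borel) (\<lambda>e z. z e) E"
    proof (subst indep_vars_iff_distr_eq_PiM' [OF E])
      show "distr ?P (PiM E (\<lambda>_. borel)) (\<lambda>z. \<lambda>e\<in>E. z e) = PiM E (\<lambda>e. distr ?P borel (\<lambda>z. z e))"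
      proof -
        \<comment> \<open>Points of the product are extensional, so the tuple of coordinates is the
          identity and its joint law is the product measure itself.\<close>
        have "distr ?P (PiM E (\<lambda>_. borel)) (\<lambda>z. \<lambda>e\<in>E. z e) = distr ?P ?P (\<lambda>z. z)"
          by (intro distr_cong sets_PiM_cong) (auto simp: space_PiM PiE_def extensional_restrict gaussian_def)
        also have "\<dots> = PiM E (\<lambda>e. distr ?P borel (\<lambda>z. z e))"
          by (simp add: coord cong: PiM_cong)
        finally show ?thesis .
      qed
    qed (rule meas)
    then have "indep_vars (\<lambda>_. borel) (\<lambda>e z. z e) ?E"
      by (rule indep_vars_subset) auto
    then have indep: "indep_vars (\<lambda>_. borel) (\<lambda>e z. d e * z e) ?E"
      by (rule indep_vars_compose2) auto
    have std: "distributed ?P lborel (\<lambda>z. z e) (normal_density 0 1)" if "e \<in> E" for e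
      using coord [OF that] meas [OF that]
      by (auto simp: distributed_def gaussian_def cong: distr_cong)
    \<comment> \<open>The affine rule serves twice: with shift 0 for the scaling by
      \<open>d e\<close>, and below with factor 1 for the translation by \<open>b\<close>.\<close>
    have "distributed ?P lborel (\<lambda>z. 0 + d e * z e) (normal_density (0 + d e * 0) (\<bar>d e\<bar> * 1))"
      if "e \<in> ?E" for e
      using that by (intro normal_density_affine std) auto
    then have "distributed ?P lborel (\<lambda>z. \<Sum>e\<in>?E. d e * z e)
        (normal_density (\<Sum>e\<in>?E. 0) (sqrt (\<Sum>e\<in>?E. \<bar>d e\<bar>\<^sup>2)))"
      using \<open>finite E\<close> False indep by (intro sum_indep_normal) auto
    moreover have pos: "0 < sqrt (\<Sum>e\<in>?E. \<bar>d e\<bar>\<^sup>2)"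
      using \<open>finite E\<close> False by (simp only: real_sqrt_gt_0_iff) (rule sum_pos, auto)
    ultimately have "distributed ?P lborel (\<lambda>z. b + 1 * (\<Sum>e\<in>?E. d e * z e))
        (normal_density (b + 1 * (\<Sum>e\<in>?E. 0)) (\<bar>1\<bar> * sqrt (\<Sum>e\<in>?E. \<bar>d e\<bar>\<^sup>2)))"
      by (intro normal_density_affine) auto
    then show ?thesis
      unfolding sum_eq sq_eq using pos
      by (simp add: distributed_def gaussian_def cong: distr_cong)
  qed
qed

section \<open>Splitting the variances into pair weights\<close>

text \<open>Both sides are the length of \<open>[a, b] \<inter> [c + h, d + h]\<close>.\<close>

lemma interval_overlap_shift:
  fixes a b c d h :: real
  assumes "a \<le> b" "c \<le> d"
  shows "max a (min (d + h) b) - max a (min (c + h) b) =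
         max c (min (b - h) d) - max c (min (a - h) d)"
  using assms by (auto simp: max_def min_def)

text \<open>Lay arcs of lengths \<open>v 0, \<dots>, v (n - 1)\<close> around a circle of circumference \<open>2 h = \<Sum>v\<close>. The
  half-turn carries no arc to one overlapping it, since no arc is longer than \<open>h\<close>. The weight \<open>w i j\<close>
  is the length of the part of arc \<open>i\<close> in \<open>[h, 2 h]\<close> that the half-turn carries into arc \<open>j\<close>; \<open>w j i\<close>
  is the same for the part in \<open>[0, h]\<close>.\<close>

lemma exists_pair_weights:
  fixes v :: "nat \<Rightarrow> real"
  assumes nonneg: "\<And>i. i < n \<Longrightarrow> 0 \<le> v i" and max: "\<And>i. i < n \<Longrightarrow> 2 * v i \<le> (\<Sum>j<n. v j)"
  obtains w where "\<And>i j. i < n \<Longrightarrow> j < n \<Longrightarrow> 0 \<le> w i j" "\<And>i. i < n \<Longrightarrow> w i i = 0"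
    "\<And>i. i < n \<Longrightarrow> (\<Sum>j<n. w i j + w j i) = v i"
proof -
  define s where "s k = (\<Sum>j<k. v j)" for k
  define h where "h = s n / 2"
  \<comment> \<open>Projection onto arc \<open>i\<close>, which is \<open>[s i, s (Suc i)]\<close>.
    For \<open>x \<le> y\<close>, the difference \<open>clip i y - clip i x\<close> is the length of
    the part of the arc in \<open>[x, y]\<close>.\<close>
  define clip where "clip i x = max (s i) (min x (s (Suc i)))" for i x
  define w where "w i j = clip i (s (Suc j) + h) - clip i (s j + h)" for i j
  have step: "s i \<le> s (Suc i)" "s (Suc i) \<le> s i + h" if "i < n" for i
    using nonneg [OF that] max [OF that] by (auto simp: s_def h_def)
  have range: "0 \<le> s i" "s (Suc i) \<le> s n" if "i < n" for i
    unfolding s_def using nonneg that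
    by (intro sum_nonneg sum_mono2; force)+
  have h: "0 \<le> h"
    using nonneg by (auto simp: h_def s_def intro!: sum_nonneg)
  \<comment> \<open>Shifting back by \<open>h\<close> expresses \<open>w j i\<close> through arc
    \<open>i\<close> as well, so that both sums over \<open>j\<close> telescope.\<close>
  have w_flip: "w j i = clip i (s (Suc j) - h) - clip i (s j - h)" if "i < n" "j < n" for i j
    unfolding w_def clip_def by (rule interval_overlap_shift) (use step that in auto)
  show thesis
  proof (rule that [of w])
    show "0 \<le> w i j" if "i < n" "j < n" for i j
      unfolding w_def clip_def using step(1) [OF that(2)] by (auto simp: max_def min_def)
    \<comment> \<open>Arc \<open>i\<close> ends no later than \<open>s i + h\<close>, so both terms
      of the difference are clipped to \<open>s (Suc i)\<close>.\<close>
    show "w i i = 0" if "i < n" for i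
      unfolding w_def clip_def using step [OF that] h by (auto simp: max_def min_def)
    show "(\<Sum>j<n. w i j + w j i) = v i" if i: "i < n" for i
    proof -
      have "(\<Sum>j<n. w i j + w j i) = (\<Sum>j<n. clip i (s (Suc j) + h) - clip i (s j + h)) +
          (\<Sum>j<n. clip i (s (Suc j) - h) - clip i (s j - h))"
        unfolding sum.distrib [symmetric] using w_flip [OF i] by (intro sum.cong) (auto simp: w_def)
      also have "\<dots> = clip i (s n + h) - clip i (s 0 + h) + (clip i (s n - h) - clip i (s 0 - h))"
        using sum_lessThan_telescope [of "\<lambda>j. clip i (s j + h)" n]
          sum_lessThan_telescope [of "\<lambda>j. clip i (s j - h)" n] by simp
      \<comment> \<open>Since \<open>s 0 + h = h = s n - h\<close>, the inner terms cancel: the two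
        shifted copies of the circle join to the interval \<open>[- h, s n + h]\<close>, which
        contains arc \<open>i\<close>.\<close>
      also have "\<dots> = clip i (s n + h) - clip i (- h)"
        by (simp add: h_def s_def)
      also have "\<dots> = s (Suc i) - s i"
        using range [OF i] step [OF i] h by (auto simp: clip_def)
      finally show ?thesis by (simp add: s_def)
    qed
  qed
qed

section \<open>Construction of the Gaussian joint mix\<close>

lemma exists_gaussian_joint_mix:
  fixes \<mu> \<sigma> :: "nat \<Rightarrow> real"
  assumes nonneg: "\<And>i. i \<in> {1..n} \<Longrightarrow> 0 \<le> \<sigma> i"
    and F: "\<And>i. i \<in> {1..n} \<Longrightarrow> F i = gaussian (\<mu> i) (\<sigma> i)"
    and max: "\<And>i. i \<in> {1..n} \<Longrightarrow> 2 * (\<sigma> i)\<^sup>2 \<le> (\<Sum>i\<in>{1..n}. (\<sigma> i)\<^sup>2)"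
  obtains M :: "(nat \<Rightarrow> real) measure" and X
  where "joint_mix_with_marginals n F M X" "NA n M X" "gaussian_vector n M X"
proof -
  have shift: "sum u {1..n} = (\<Sum>k<n. u (Suc k))" for u :: "nat \<Rightarrow> real"
    by (simp add: sum.atLeast1_atMost_eq)
  obtain w where w: "\<And>i j. i < n \<Longrightarrow> j < n \<Longrightarrow> 0 \<le> w i j" "\<And>i. i < n \<Longrightarrow> w i i = 0"
    "\<And>i. i < n \<Longrightarrow> (\<Sum>j<n. w i j + w j i) = (\<sigma> (Suc i))\<^sup>2"
    using exists_pair_weights [of n "\<lambda>i. (\<sigma> (Suc i))\<^sup>2"] max unfolding shift by auto
  define E where "E = {..<n} \<times> {..<n}"
  \<comment> \<open>Pairs are indexed from 0 and coordinates from 1, hence \<open>Suc\<close>. On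
    the diagonal \<open>p = q\<close> the coefficient is 0.\<close>
  define c where "c i e = (case e of (p, q) \<Rightarrow>
      sqrt (w p q) * (of_bool (i = Suc p) - of_bool (i = Suc q)))" for i and e :: "nat \<times> nat"
  define P where "P = PiM E (\<lambda>_. gaussian 0 1)"
  define X where "X i z = \<mu> i + (\<Sum>e\<in>E. c i e * z e)" for i and z :: "nat \<times> nat \<Rightarrow> real"
  have N: "prob_space (gaussian 0 1)" "sets (gaussian 0 1) = sets borel"
    by (simp_all add: gaussian_def prob_space_normal_density)
  have E: "finite E" by (simp add: E_def)
  have var: "(\<Sum>e\<in>E. (c i e)\<^sup>2) = (\<sigma> i)\<^sup>2" if i: "i \<in> {1..n}" for i
  proof -
    obtain k where k: "i = Suc k" "k < n"
      using i by (cases i) auto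
    have "(\<Sum>e\<in>E. (c i e)\<^sup>2) = (\<Sum>p<n. \<Sum>q<n. (c i (p, q))\<^sup>2)"
      by (simp add: E_def sum.cartesian_product)
    \<comment> \<open>At \<open>p = q = k\<close> the square is 0 while the right side is
      \<open>2 * w k k\<close>; they agree because diagonal weights vanish.\<close>
    also have "\<dots> = (\<Sum>p<n. \<Sum>q<n. (if p = k then w p q else 0) + (if q = k then w p q else 0))"
      using w(1,2) k by (intro sum.cong refl) (auto simp: c_def power_mult_distrib of_bool_def)
    also have "\<dots> = (\<Sum>p<n. if p = k then \<Sum>q<n. w p q else 0) + (\<Sum>p<n. w p k)"
      unfolding sum.distrib using k by (intro arg_cong2 [where f = "(+)"] sum.cong refl) auto
    also have "\<dots> = (\<sigma> i)\<^sup>2"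
      using w(3) k by (simp add: sum.distrib)
    finally show ?thesis .
  qed
  have balanced: "(\<Sum>i\<in>{1..n}. c i e) = 0" if "e \<in> E" for e
  proof -
    obtain p q where e: "e = (p, q)" "p < n" "q < n" using \<open>e \<in> E\<close> by (auto simp: E_def)
    then have "(\<Sum>i\<in>{1..n}. of_bool (i = Suc p) - of_bool (i = Suc q)) = (0 :: real)"
      by (simp add: sum_subtractf of_bool_def)
    then show ?thesis
      by (simp add: c_def e flip: sum_distrib_left)
  qed
  have NA: "NA n P X"
    unfolding P_def X_def
  proof (rule NA_independent_linear [OF N E])
    fix i j :: nat and e assume "i \<noteq> j" "e \<in> E"
    \<comment> \<open>The product is nonzero only if \<open>i\<close> and \<open>j\<close> are the
      two ends of the pair; it is then minus the pair's weight.\<close>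
    then show "c i e * c j e \<le> 0"
      using w(1) by (auto simp: c_def E_def of_bool_def)
  qed
  then have rv: "random_vector n P X" by (simp add: NA_def)
  have law: "distr P borel (\<lambda>z. \<Sum>i\<in>{1..n}. a i * X i z) =
      gaussian (\<Sum>i\<in>{1..n}. a i * \<mu> i) (sqrt (\<Sum>e\<in>E. (\<Sum>i\<in>{1..n}. a i * c i e)\<^sup>2))" for a
  proof -
    have "(\<Sum>i\<in>{1..n}. a i * X i z) =
        (\<Sum>i\<in>{1..n}. a i * \<mu> i) + (\<Sum>e\<in>E. (\<Sum>i\<in>{1..n}. a i * c i e) * z e)" for z
      unfolding X_def distrib_left sum.distrib sum_distrib_left sum_distrib_right mult.assoc
      by (subst sum.swap) (rule refl)
    then show ?thesis
      unfolding P_def using gaussian_linear_combination [OF E] by simp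
  qed
  have gauss: "gaussian_vector n P X"
    unfolding gaussian_vector_def
  proof (intro conjI allI exI)
    show "distr P borel (\<lambda>z. \<Sum>i\<in>{1..n}. a i * X i z) = gaussian (\<Sum>i\<in>{1..n}. a i * \<mu> i)
        (sqrt (\<Sum>e\<in>E. (\<Sum>i\<in>{1..n}. a i * c i e)\<^sup>2))" for a
      by (rule law)
  qed (use rv in \<open>auto intro: sum_nonneg\<close>)
  have "distr P borel (X i) = F i" if i: "i \<in> {1..n}" for i
    using gaussian_linear_combination [OF E, of "\<mu> i" "c i"] var [OF i] nonneg [OF i] F [OF i]
    by (simp add: P_def X_def [abs_def])
  moreover have "(\<Sum>i\<in>{1..n}. X i z) = (\<Sum>i\<in>{1..n}. \<mu> i)" for z
    using balanced unfolding X_def sum.distrib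
    by (subst sum.swap) (simp flip: sum_distrib_right)
  ultimately have "joint_mix_with_marginals n F P X"
    using rv by (auto simp: joint_mix_with_marginals_def joint_mix_def)
  \<comment> \<open>The sample space so far consists of functions on pairs. Passing to the law of
    \<open>X\<close> gives one of the required type.\<close>
  then show thesis
    using NA gauss joint_mix_with_marginals_vector_law NA_vector_law gaussian_vector_vector_law that
    by blast
qed

lemma joint_mix_gaussian_moments:
  assumes "joint_mix_with_marginals n F M X" "i \<in> {1..n}" "F i = gaussian m s" "0 \<le> s"
  shows "square_integrable M (X i)" "covariance M (X i) (X i) = s\<^sup>2"
  using assms prob_space.gaussian_moments [of M "X i" m s]
  by (auto simp: joint_mix_with_marginals_def joint_mix_def random_vector_def)

text \<open>An NA joint mix with these marginals is also NCD. So necessity is shown for NCD and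
  existence for NA, and each half serves both equivalences.\<close>

theorem theorem2:
  fixes n :: nat and F :: "nat \<Rightarrow> real measure" and \<mu> \<sigma> :: "nat \<Rightarrow> real"
  assumes "n \<ge> 1"
    and "\<And>i. i \<in> {1..n} \<Longrightarrow> \<sigma> i \<ge> 0"
    and "\<And>i. i \<in> {1..n} \<Longrightarrow> F i = gaussian (\<mu> i) (\<sigma> i)"
  shows "(supports_NCD_joint_mix n F \<longleftrightarrow>
            2 * (MAX i\<in>{1..n}. (\<sigma> i)\<^sup>2) \<le> (\<Sum>i\<in>{1..n}. (\<sigma> i)\<^sup>2))
       \<and> (supports_NA_joint_mix n F \<longleftrightarrow>
            2 * (MAX i\<in>{1..n}. (\<sigma> i)\<^sup>2) \<le> (\<Sum>i\<in>{1..n}. (\<sigma> i)\<^sup>2))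
       \<and> (2 * (MAX i\<in>{1..n}. (\<sigma> i)\<^sup>2) \<le> (\<Sum>i\<in>{1..n}. (\<sigma> i)\<^sup>2) \<longrightarrow>
            (\<exists>(M :: (nat \<Rightarrow> real) measure) X.
               joint_mix_with_marginals n F M X \<and> NCD n M X \<and> gaussian_vector n M X)
          \<and> (\<exists>(M :: (nat \<Rightarrow> real) measure) X.
               joint_mix_with_marginals n F M X \<and> NA n M X \<and> gaussian_vector n M X))"
proof -
  let ?ineq = "2 * (MAX i\<in>{1..n}. (\<sigma> i)\<^sup>2) \<le> (\<Sum>i\<in>{1..n}. (\<sigma> i)\<^sup>2)"
  have moments: "square_integrable M (X i)" "covariance M (X i) (X i) = (\<sigma> i)\<^sup>2"
    if "joint_mix_with_marginals n F M X" "i \<in> {1..n}" for M :: "(nat \<Rightarrow> real) measure" and X i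
    using joint_mix_gaussian_moments [OF that assms(3,2)] that(2) by auto
  have NCD: "NCD n M X" if "joint_mix_with_marginals n F M X" "NA n M X"
    for M :: "(nat \<Rightarrow> real) measure" and X
    using that moments(1) by (intro NA_imp_NCD) auto
  have necessary: ?ineq if mix: "joint_mix_with_marginals n F M X" "NCD n M X"
    for M :: "(nat \<Rightarrow> real) measure" and X
  proof -
    \<comment> \<open>As \<open>n \<ge> 1\<close>, the maximum is over a nonempty set and is
      attained at some \<open>k\<close>.\<close>
    have "(MAX i\<in>{1..n}. (\<sigma> i)\<^sup>2) \<in> (\<lambda>i. (\<sigma> i)\<^sup>2) ` {1..n}"
      using assms(1) by (intro Max_in) auto
    then obtain k where k: "k \<in> {1..n}" "(MAX i\<in>{1..n}. (\<sigma> i)\<^sup>2) = (\<sigma> k)\<^sup>2"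
      by auto
    have "(\<sigma> k)\<^sup>2 \<le> (\<Sum>i\<in>{1..n} - {k}. (\<sigma> i)\<^sup>2)"
      using NCD_joint_mix_variance_le [OF _ mix(2) k(1)] moments(2) [OF mix(1)] mix(1) k(1)
      by (simp add: joint_mix_with_marginals_def)
    then show ?ineq
      using k sum.remove [OF finite_atLeastAtMost k(1), of "\<lambda>i. (\<sigma> i)\<^sup>2"] by simp
  qed
  have sufficient: "\<exists>(M :: (nat \<Rightarrow> real) measure) X.
      joint_mix_with_marginals n F M X \<and> NA n M X \<and> gaussian_vector n M X" if ?ineq
  proof -
    have "2 * (\<sigma> i)\<^sup>2 \<le> (\<Sum>i\<in>{1..n}. (\<sigma> i)\<^sup>2)" if "i \<in> {1..n}" for i
    proof -
      have "(\<sigma> i)\<^sup>2 \<le> (MAX i\<in>{1..n}. (\<sigma> i)\<^sup>2)"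
        using that by (intro Max_ge) auto
      then show ?thesis using \<open>?ineq\<close> by linarith
    qed
    then obtain M :: "(nat \<Rightarrow> real) measure" and X
      where "joint_mix_with_marginals n F M X" "NA n M X" "gaussian_vector n M X"
      using exists_gaussian_joint_mix [of n \<sigma> F \<mu>, OF assms(2,3)] by blast
    then show ?thesis by blast
  qed
  show ?thesis
    unfolding supports_NCD_joint_mix_def supports_NA_joint_mix_def
    using NCD necessary sufficient by blast
qed

end
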